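(* Suppose that $\alpha(x,y)=\frac{1}{x+c_1(y)}$, which is of special type I. Then the induced metric on a $p$-minimal surface with this $\alpha$ as its $\alpha$-function (in compatible coordinates $(x,y)$) is given by $$a=\frac{\alpha^2\,h(y)}{\sqrt{1+\alpha^2}},\qquad b=\frac{\alpha^2\,e^{k(y)}}{\sqrt{1+\alpha^2}},$$ for some functions $h(y)$ and $k(y)$.
   Context: The Heisenberg group $H_1$ is $\mathbb{R}^3$ with the group law $(x_1,y_1,z_1)\circ(x_2,y_2,z_2)=(x_1+x_2,\,y_1+y_2,\,z_1+z_2+y_1x_2-x_1y_2)$. Left invariant fields: $\mathring e_1=\partial_x+y\partial_z$, $\mathring e_2=\partial_y-x\partial_z$, $T=\partial_z$. Contact form $\Theta=dz+x\,dy-y\,dx$, contact bundle $\xi=\ker\Theta$, $J\mathring e_1=\mathring e_2$, $J\mathring e_2=-\mathring e_1$. The adapted metric makes $\mathring e_1,\mathring e_2,T$ orthonormal; $\nabla$ is the connection for which they are parallel. All objects are $C^\infty$. For a surface $\Sigma\subset H_1$ without singular points (points with $T_p\Sigma=\xi_p$) choose a unit field $e_1\in T\Sigma\cap\xi$, $e_2=Je_1$; $H$ is defined by $\nabla_{e_1}e_2=-He_1$; $p$-minimal means $H=0$. The $\alpha$-function is defined by $\alpha e_2+T\in T\Sigma$; $\hat e_1=e_1$, $\hat e_2=\frac{\alpha e_2+T}{\sqrt{1+\alpha^2}}$ is an orthonormal frame of $T\Sigma$. Compatible coordinates $(x,y)$: $e_1=\partial_x$; then the induced metric is represented by the functions $a,b$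 with $\hat e_2=a\,\partial_x+b\,\partial_y$, coordinates being taken with $b>0$. Coordinate domains are local, with connected $x$-slices. *)

theory Defs
  imports "HOL-Analysis.Analysis"
begin

primrec Ck_on ::
  "nat \<Rightarrow> ('a::euclidean_space \<Rightarrow> 'b::real_normed_vector) \<Rightarrow> 'a set \<Rightarrow> bool" where
  "Ck_on 0 f S \<longleftrightarrow> continuous_on S f"
| "Ck_on (Suc k) f S \<longleftrightarrow>
     (\<forall>x\<in>S. f differentiable (at x)) \<and>
     (\<forall>v. Ck_on k (\<lambda>x. frechet_derivative f (at x) v) S)"

(* C^infinity; only meant for open S, since derivatives are taken in the ambient space. *)
definition smooth_on ::
  "'a::euclidean_space set \<Rightarrow> ('a \<Rightarrow> 'b::real_normed_vector) \<Rightarrow> bool" where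
  "smooth_on S f \<longleftrightarrow> (\<forall>k. Ck_on k f S)"

definition heis_mult :: "real^3 \<Rightarrow> real^3 \<Rightarrow> real^3" where
  "heis_mult p q =
     vector [p$1 + q$1, p$2 + q$2, p$3 + q$3 + p$2 * q$1 - p$1 * q$2]"

definition E1 :: "real^3 \<Rightarrow> real^3" where
  "E1 p = vector [1, 0, p$2]"

definition E2 :: "real^3 \<Rightarrow> real^3" where
  "E2 p = vector [0, 1, - p$1]"

definition Reeb :: "real^3 \<Rightarrow> real^3" where
  "Reeb p = vector [0, 0, 1]"

(* Theta = dz + x dy - y dx, evaluated at the point p on the tangent vector v. *)
definition contact_form :: "real^3 \<Rightarrow> real^3 \<Rightarrow> real" where
  "contact_form p v = v$3 + p$1 * v$2 - p$2 * v$1"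

definition contact_plane :: "real^3 \<Rightarrow> (real^3) set" where
  "contact_plane p = {v. contact_form p v = 0}"

(* Coordinates of v with respect to the frame E1 p, E2 p, Reeb p; see frame_expansion. *)
definition frame_coeffs :: "real^3 \<Rightarrow> real^3 \<Rightarrow> real^3" where
  "frame_coeffs p v = vector [v$1, v$2, contact_form p v]"

(* J is only meaningful on the contact plane; the definition extends it by J Reeb = 0. *)
definition J :: "real^3 \<Rightarrow> real^3 \<Rightarrow> real^3" where
  "J p v = frame_coeffs p v $ 1 *\<^sub>R E2 p - frame_coeffs p v $ 2 *\<^sub>R E1 p"

definition adapted_metric :: "real^3 \<Rightarrow> real^3 \<Rightarrow> real^3 \<Rightarrow> real" where
  "adapted_metric p v w = frame_coeffs p v \<bullet> frame_coeffs p w"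

lemma frame_expansion:
  "v = frame_coeffs p v $ 1 *\<^sub>R E1 p + frame_coeffs p v $ 2 *\<^sub>R E2 p
       + frame_coeffs p v $ 3 *\<^sub>R Reeb p"
  by (simp add: vec_eq_iff forall_3 frame_coeffs_def E1_def E2_def Reeb_def contact_form_def)

lemma adapted_metric_orthonormal:
  "adapted_metric p (E1 p) (E1 p) = 1" "adapted_metric p (E2 p) (E2 p) = 1"
  "adapted_metric p (Reeb p) (Reeb p) = 1" "adapted_metric p (E1 p) (E2 p) = 0"
  "adapted_metric p (E1 p) (Reeb p) = 0" "adapted_metric p (E2 p) (Reeb p) = 0"
  by (simp_all add: adapted_metric_def frame_coeffs_def E1_def E2_def Reeb_def
      contact_form_def inner_vec_def sum_3)

lemma J_frame: "J p (E1 p) = E2 p" "J p (E2 p) = - E1 p"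
  by (simp_all add: J_def frame_coeffs_def E1_def E2_def)

(* The differential of left translation by p sends the frame at q to the frame at p o q. *)
lemma frame_left_invariant:
  assumes "(heis_mult p has_derivative L) (at q)"
  shows "L (E1 q) = E1 (heis_mult p q)" "L (E2 q) = E2 (heis_mult p q)"
    "L (Reeb q) = Reeb (heis_mult p q)"
proof -
  let ?L = "\<lambda>v::real^3. vector [v$1, v$2, v$3 + p$2 * v$1 - p$1 * v$2] :: real^3"
  have "linear ?L"
    by (rule linearI) (simp_all add: vec_eq_iff forall_3 algebra_simps)
  then have "(?L has_derivative ?L) (at q)"
    by (simp add: bounded_linear_imp_has_derivative linear_conv_bounded_linear)
  then have "((\<lambda>v. p + ?L v) has_derivative ?L) (at q)"
    using has_derivative_add[OF has_derivative_const[of p]] by fastforce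
  moreover have "heis_mult p = (\<lambda>v. p + ?L v)"
    by (simp add: fun_eq_iff heis_mult_def vec_eq_iff forall_3)
  ultimately have "(heis_mult p has_derivative ?L) (at q)"
    by (simp only:)
  then have "L = ?L"
    by (rule has_derivative_unique[OF assms])
  then show "L (E1 q) = E1 (heis_mult p q)" "L (E2 q) = E2 (heis_mult p q)"
    "L (Reeb q) = Reeb (heis_mult p q)"
    by (simp_all add: E1_def E2_def Reeb_def heis_mult_def vec_eq_iff forall_3)
qed

definition tangent_space :: "(real^3) set \<Rightarrow> real^3 \<Rightarrow> (real^3) set" where
  "tangent_space S p =
     {v. \<exists>\<gamma> \<epsilon>. \<epsilon> > 0 \<and> smooth_on {-\<epsilon><..<\<epsilon>} \<gamma> \<and> \<gamma> ` {-\<epsilon><..<\<epsilon>} \<subseteq> S \<and> \<gamma> 0 = p \<and>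
         (\<gamma> has_vector_derivative v) (at (0::real))}"

definition local_parametrization ::
  "(real^3) set \<Rightarrow> (real \<times> real) set \<Rightarrow> (real \<times> real \<Rightarrow> real^3) \<Rightarrow> bool" where
  "local_parametrization S U F \<longleftrightarrow>
     open U \<and> smooth_on U F \<and>
     (\<forall>u\<in>U. inj (frechet_derivative F (at u))) \<and>
     openin (top_of_set S) (F ` U) \<and>
     (\<exists>G. homeomorphism U (F ` U) F G)"

definition regular_surface :: "(real^3) set \<Rightarrow> bool" where
  "regular_surface S \<longleftrightarrow>
     (\<forall>p\<in>S. \<exists>U F. local_parametrization S U F \<and> p \<in> F ` U)"

definition smooth_on_surface ::
  "(real^3) set \<Rightarrow> (real^3 \<Rightarrow> 'b::real_normed_vector) \<Rightarrow> bool" where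
  "smooth_on_surface S f \<longleftrightarrow>
     (\<forall>U F. local_parametrization S U F \<longrightarrow> smooth_on U (\<lambda>u. f (F u)))"

definition nonsingular_surface :: "(real^3) set \<Rightarrow> bool" where
  "nonsingular_surface S \<longleftrightarrow>
     regular_surface S \<and> (\<forall>p\<in>S. tangent_space S p \<noteq> contact_plane p)"

(* A choice of the unit field e_1 in T S \<inter> xi; e_2 is then J p (e1 p). *)
definition characteristic_field :: "(real^3) set \<Rightarrow> (real^3 \<Rightarrow> real^3) \<Rightarrow> bool" where
  "characteristic_field S e1 \<longleftrightarrow>
     smooth_on_surface S e1 \<and>
     (\<forall>p\<in>S. e1 p \<in> tangent_space S p \<inter> contact_plane p \<and>
            adapted_metric p (e1 p) (e1 p) = 1)"

(* nabla_v W = w at p, for a field W along S and a vector v tangent to S at p. As the left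
   invariant frame is parallel, the frame coefficients of W are differentiated. The derivative
   D within S need not be unique as a linear map, but its value on tangent vectors is. *)
definition has_covariant_derivative ::
  "(real^3) set \<Rightarrow> (real^3 \<Rightarrow> real^3) \<Rightarrow> real^3 \<Rightarrow> real^3 \<Rightarrow> real^3 \<Rightarrow> bool" where
  "has_covariant_derivative S W p v w \<longleftrightarrow>
     (\<exists>D. ((\<lambda>q. frame_coeffs q (W q)) has_derivative D) (at p within S) \<and>
          frame_coeffs p w = D v)"

definition has_p_mean_curvature ::
  "(real^3) set \<Rightarrow> (real^3 \<Rightarrow> real^3) \<Rightarrow> (real^3 \<Rightarrow> real) \<Rightarrow> bool" where
  "has_p_mean_curvature S e1 H \<longleftrightarrow>
     (\<forall>p\<in>S. has_covariant_derivative S (\<lambda>q. J q (e1 q)) p (e1 p) (- H p *\<^sub>R e1 p))"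

definition p_minimal :: "(real^3) set \<Rightarrow> (real^3 \<Rightarrow> real^3) \<Rightarrow> bool" where
  "p_minimal S e1 \<longleftrightarrow> has_p_mean_curvature S e1 (\<lambda>_. 0)"

definition alpha_function ::
  "(real^3) set \<Rightarrow> (real^3 \<Rightarrow> real^3) \<Rightarrow> (real^3 \<Rightarrow> real) \<Rightarrow> bool" where
  "alpha_function S e1 \<alpha> \<longleftrightarrow>
     smooth_on_surface S \<alpha> \<and>
     (\<forall>p\<in>S. \<alpha> p *\<^sub>R J p (e1 p) + Reeb p \<in> tangent_space S p)"

definition e2_hat :: "(real^3 \<Rightarrow> real^3) \<Rightarrow> (real^3 \<Rightarrow> real) \<Rightarrow> real^3 \<Rightarrow> real^3" where
  "e2_hat e1 \<alpha> p = (1 / sqrt (1 + (\<alpha> p)\<^sup>2)) *\<^sub>R (\<alpha> p *\<^sub>R J p (e1 p) + Reeb p)"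

definition compatible_coordinates ::
  "(real^3) set \<Rightarrow> (real^3 \<Rightarrow> real^3) \<Rightarrow> (real \<times> real) set \<Rightarrow>
   (real \<times> real \<Rightarrow> real^3) \<Rightarrow> bool" where
  "compatible_coordinates S e1 U F \<longleftrightarrow>
     local_parametrization S U F \<and>
     (\<forall>u\<in>U. frechet_derivative F (at u) (1, 0) = e1 (F u)) \<and>
     (\<forall>y. connected {x. (x, y) \<in> U})"

(* The induced metric is encoded by a, b through e2_hat = a d/dx + b d/dy. *)
definition induced_metric_represented_by ::
  "(real^3 \<Rightarrow> real^3) \<Rightarrow> (real^3 \<Rightarrow> real) \<Rightarrow> (real \<times> real) set \<Rightarrow> (real \<times> real \<Rightarrow> real^3) \<Rightarrow>
   (real \<times> real \<Rightarrow> real) \<Rightarrow> (real \<times> real \<Rightarrow> real) \<Rightarrow> bool" where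
  "induced_metric_represented_by e1 \<alpha> U F a b \<longleftrightarrow>
     smooth_on U a \<and> smooth_on U b \<and>
     (\<forall>u\<in>U. b u > 0 \<and>
        e2_hat e1 \<alpha> (F u) =
          a u *\<^sub>R frechet_derivative F (at u) (1, 0) +
          b u *\<^sub>R frechet_derivative F (at u) (0, 1))"

end

theory Submission
  imports Defs
begin

text \<open>
  Write \<open>F\<^sub>x = p E1 + q E2\<close>. The equation \<open>H = 0\<close> says that \<open>F\<^sub>x\<close> is constant along the
  \<open>x\<close>-slices, so the slices are mapped to lines and \<open>F\<^sub>y\<close> is affine in \<open>x\<close>. Put
  \<open>V = \<Theta>(F\<^sub>y)\<close> and let \<open>n\<close> be the \<open>e\<^sub>2\<close>-component of \<open>F\<^sub>y\<close>. Expanding the second frame vector in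
  \<open>F\<^sub>x, F\<^sub>y\<close> gives \<open>b \<surd>(1 + \<alpha>\<^sup>2) V = 1\<close>, \<open>n = \<alpha> V\<close>, and that \<open>- a / b\<close> is the
  \<open>e\<^sub>1\<close>-component of \<open>F\<^sub>y\<close>, which is constant on slices because \<open>p\<^sup>2 + q\<^sup>2 = 1\<close>. Along a slice \<open>V\<close> is
  quadratic with derivative \<open>2 n = 2 \<alpha> V\<close>; for \<open>\<alpha> = 1 / (x + c\<^sub>1)\<close> this forces \<open>V\<close> to be a multiple
  of \<open>(x + c\<^sub>1)\<^sup>2\<close>, whence \<open>b \<surd>(1 + \<alpha>\<^sup>2) / \<alpha>\<^sup>2\<close> depends on \<open>y\<close> only.
\<close>

section \<open>Closure properties of the class C^k\<close>

lemma Ck_on_has_derivative: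
  assumes "Ck_on (Suc k) f S" "x \<in> S"
  shows "(f has_derivative frechet_derivative f (at x)) (at x)"
  using assms by (auto simp: frechet_derivative_works)

lemma Ck_on_cong:
  assumes "open S" "\<And>x. x \<in> S \<Longrightarrow> f x = g x" "Ck_on k f S"
  shows "Ck_on k g S"
  using assms(2,3)
proof (induction k arbitrary: f g)
  case 0
  then show ?case using continuous_on_cong[of S S f g] by simp
next
  case (Suc k)
  have g: "(g has_derivative frechet_derivative f (at x)) (at x)" if "x \<in> S" for x
    using Ck_on_has_derivative[OF Suc.prems(2) that] assms(1) that Suc.prems(1)
    by (rule has_derivative_transform_within_open)
  have "Ck_on k (\<lambda>x. frechet_derivative g (at x) v) S" for v
  proof (rule Suc.IH)
    show "Ck_on k (\<lambda>x. frechet_derivative f (at x) v) S" using Suc.prems(2) by simp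
    show "frechet_derivative f (at x) v = frechet_derivative g (at x) v" if "x \<in> S" for x
      using frechet_derivative_at[OF g[OF that]] by simp
  qed
  then show ?case using g by (auto simp: differentiable_def)
qed

text \<open>Admits any explicit derivative formula \<open>f'\<close>: it agrees with
  \<open>frechet_derivative\<close> by uniqueness, so each closure property below reduces to a
  calculus rule.\<close>

lemma Ck_on_SucI:
  assumes "open S" "\<And>x. x \<in> S \<Longrightarrow> (f has_derivative f' x) (at x)"
    and "\<And>v. Ck_on k (\<lambda>x. f' x v) S"
  shows "Ck_on (Suc k) f S"
proof -
  have "Ck_on k (\<lambda>x. frechet_derivative f (at x) v) S" for v
    using assms(1) _ assms(3)[of v]
    by (rule Ck_on_cong) (simp add: frechet_derivative_at[OF assms(2), symmetric])
  then show ?thesis using assms(2) by (auto simp: differentiable_def)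
qed

lemma Ck_on_SucD: "Ck_on (Suc k) f S \<Longrightarrow> Ck_on k f S"
proof (induction k arbitrary: f)
  case 0
  then show ?case
    by (auto intro!: differentiable_imp_continuous_within continuous_at_imp_continuous_on)
next
  case (Suc k)
  from Suc.prems have d: "\<forall>x\<in>S. f differentiable at x"
    and c: "\<And>v. Ck_on (Suc k) (\<lambda>x. frechet_derivative f (at x) v) S"
    by simp_all
  from Suc.IH[OF c] d show ?case by simp
qed

lemma Ck_on_const: "open S \<Longrightarrow> Ck_on k (\<lambda>_. c) S"
  by (induction k arbitrary: c) (simp_all del: Ck_on.simps(2) add: Ck_on_SucI[OF _ has_derivative_const])

lemma Ck_on_add:
  assumes "open S" "Ck_on k f S" "Ck_on k g S"
  shows "Ck_on k (\<lambda>x. f x + g x) S"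
  using assms(2,3)
proof (induction k arbitrary: f g)
  case 0
  then show ?case by (simp add: continuous_on_add)
next
  case (Suc k)
  show ?case
    by (rule Ck_on_SucI[OF assms(1) has_derivative_add[OF Ck_on_has_derivative[OF Suc.prems(1)]
            Ck_on_has_derivative[OF Suc.prems(2)]]])
      (use Suc in auto)
qed

lemma Ck_on_mult:
  fixes f g :: "'a::euclidean_space \<Rightarrow> real"
  assumes "open S" "Ck_on k f S" "Ck_on k g S"
  shows "Ck_on k (\<lambda>x. f x * g x) S"
  using assms(2,3)
proof (induction k arbitrary: f g)
  case 0
  then show ?case by (simp add: continuous_on_mult)
next
  case (Suc k)
  show ?case
    by (rule Ck_on_SucI[OF assms(1) has_derivative_mult[OF Ck_on_has_derivative[OF Suc.prems(1)]
            Ck_on_has_derivative[OF Suc.prems(2)]]])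
      (assumption, assumption, intro Ck_on_add assms(1) Suc.IH Ck_on_SucD[OF Suc.prems(1)] Ck_on_SucD[OF Suc.prems(2)],
        use Suc.prems in auto)
qed

lemma Ck_on_inverse:
  fixes f :: "'a::euclidean_space \<Rightarrow> real"
  assumes "open S" "Ck_on k f S" "\<And>x. x \<in> S \<Longrightarrow> f x \<noteq> 0"
  shows "Ck_on k (\<lambda>x. inverse (f x)) S"
  using assms(2)
proof (induction k)
  case 0
  then show ?case using assms(3) by (auto intro!: continuous_on_inverse)
next
  case (Suc k)
  have inv: "Ck_on k (\<lambda>x. inverse (f x)) S"
    using Suc.IH Ck_on_SucD[OF Suc.prems] by blast
  \<comment> \<open>The sign is a constant factor, so that the product and constant rules apply; the
    inverse recurs only at order \<open>k\<close>, already settled by \<open>inv\<close>.\<close>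
  have "((\<lambda>x. inverse (f x)) has_derivative
      (\<lambda>v. - 1 * (inverse (f x) * frechet_derivative f (at x) v * inverse (f x)))) (at x)"
    if "x \<in> S" for x
    using Deriv.has_derivative_inverse[OF assms(3)[OF that] Ck_on_has_derivative[OF Suc.prems that]]
    by simp
  then show ?case
    by (rule Ck_on_SucI[OF assms(1)])
      (assumption, intro Ck_on_mult Ck_on_const assms(1) inv, use Suc.prems in auto)
qed

lemma Ck_on_ln:
  fixes f :: "'a::euclidean_space \<Rightarrow> real"
  assumes "open S" "Ck_on k f S" "\<And>x. x \<in> S \<Longrightarrow> f x > 0"
  shows "Ck_on k (\<lambda>x. ln (f x)) S"
proof (cases k)
  case 0
  then show ?thesis using assms by (auto intro!: continuous_on_ln simp: less_imp_neq[symmetric])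
next
  case (Suc j)
  have f: "Ck_on (Suc j) f S" using assms(2) Suc by simp
  have "((\<lambda>x. ln (f x)) has_derivative (\<lambda>v. frechet_derivative f (at x) v * inverse (f x))) (at x)"
    if "x \<in> S" for x
    using has_derivative_ln[OF assms(3)[OF that] Ck_on_has_derivative[OF f that]] .
  then show ?thesis unfolding Suc
    by (rule Ck_on_SucI[OF assms(1)])
      (use f assms(3) in \<open>auto intro!: Ck_on_mult Ck_on_inverse assms(1) Ck_on_SucD[OF f] simp: less_imp_neq[symmetric]\<close>)
qed

lemma Ck_on_exp:
  fixes f :: "'a::euclidean_space \<Rightarrow> real"
  assumes "open S" "Ck_on k f S"
  shows "Ck_on k (\<lambda>x. exp (f x)) S"
  using assms(2)
proof (induction k)
  case 0
  then show ?case by (auto intro!: continuous_on_exp)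
next
  case (Suc k)
  have e: "Ck_on k (\<lambda>x. exp (f x)) S"
    using Suc.IH Ck_on_SucD[OF Suc.prems] by blast
  have "((\<lambda>x. exp (f x)) has_derivative (\<lambda>v. frechet_derivative f (at x) v * exp (f x))) (at x)"
    if "x \<in> S" for x
    using has_derivative_exp[OF Ck_on_has_derivative[OF Suc.prems that]] .
  then show ?case
    by (rule Ck_on_SucI[OF assms(1)])
      (use Suc.prems in \<open>auto intro!: Ck_on_mult assms(1) e\<close>)
qed

lemma Ck_on_UN:
  assumes "\<And>i. i \<in> I \<Longrightarrow> open (S i)" "\<And>i. i \<in> I \<Longrightarrow> Ck_on k f (S i)"
  shows "Ck_on k f (\<Union>i\<in>I. S i)"
  using assms(2)
proof (induction k arbitrary: f)
  case 0
  then show ?case using assms(1) by (auto intro!: continuous_on_open_UN)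
next
  case (Suc k)
  then show ?case by fastforce
qed

section \<open>Slices of product domains, and functions of the second variable alone\<close>

lemma open_Pair_slices:
  assumes "open (U :: ('a::topological_space \<times> 'b::topological_space) set)"
  shows "open {y. (x, y) \<in> U}" "open {x. (x, y) \<in> U}"
proof -
  have "open ((\<lambda>y. (x, y)) -` U)" "open ((\<lambda>x. (x, y)) -` U)"
    by (auto intro!: open_vimage assms continuous_intros)
  then show "open {y. (x, y) \<in> U}" "open {x. (x, y) \<in> U}"
    by (simp_all add: vimage_def)
qed

lemma has_derivative_Pair_slices:
  assumes "(f has_derivative f') (at (x, y))"
  shows "((\<lambda>s. f (s, y)) has_derivative (\<lambda>v. f' (v, 0))) (at x)"
    and "((\<lambda>t. f (x, t)) has_derivative (\<lambda>v. f' (0, v))) (at y)"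
  by (rule has_derivative_compose[where g = f], auto intro!: derivative_eq_intros assms)+

lemma Ck_on_slice:
  fixes f :: "'a::euclidean_space \<times> 'b::euclidean_space \<Rightarrow> 'c::real_normed_vector"
  assumes "open U" "Ck_on k f U"
  shows "Ck_on k (\<lambda>y. f (x, y)) {y. (x, y) \<in> U}"
  using assms(2)
proof (induction k arbitrary: f)
  case 0
  then show ?case
    by (auto intro!: continuous_on_compose2[of U f] continuous_intros)
next
  case (Suc k)
  show ?case
    by (rule Ck_on_SucI[OF open_Pair_slices(1)[OF assms(1)]
            has_derivative_Pair_slices(2)[OF Ck_on_has_derivative[OF Suc.prems]]])
      (use Suc in auto)
qed

text \<open>Smoothness is local: for fixed \<open>x\<close>, the descended function is a slice of
  \<open>f\<close> on the open set of all \<open>y\<close> with \<open>(x, y)\<close> in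
  \<open>U\<close>, and these sets cover the projection of \<open>U\<close>.\<close>

lemma smooth_on_descends:
  fixes f :: "'a::euclidean_space \<times> 'b::euclidean_space \<Rightarrow> 'c::real_normed_vector"
  assumes "open U" "smooth_on U f"
    and const: "\<And>x x' y. (x, y) \<in> U \<Longrightarrow> (x', y) \<in> U \<Longrightarrow> f (x, y) = f (x', y)"
  obtains g where "smooth_on (snd ` U) g" "\<And>x y. (x, y) \<in> U \<Longrightarrow> f (x, y) = g y"
proof
  define g where "g y = f (SOME x. (x, y) \<in> U, y)" for y
  show g: "f (x, y) = g y" if "(x, y) \<in> U" for x y
    unfolding g_def by (rule const[OF that someI[of "\<lambda>x. (x, y) \<in> U", OF that]])
  have "Ck_on k g {y. (x, y) \<in> U}" for k x
    using open_Pair_slices(1)[OF assms(1)] _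
      Ck_on_slice[OF assms(1) assms(2)[unfolded smooth_on_def, rule_format]]
    by (rule Ck_on_cong) (simp add: g)
  then have "Ck_on k g (\<Union>x. {y. (x, y) \<in> U})" for k
    by (intro Ck_on_UN open_Pair_slices(1)[OF assms(1)]) auto
  moreover have "(\<Union>x. {y. (x, y) \<in> U}) = snd ` U" by force
  ultimately show "smooth_on (snd ` U) g" by (simp add: smooth_on_def)
qed

section \<open>Pointwise algebra of the frame and the contact form\<close>

lemma frame_coeffs_J: "frame_coeffs p (J p v) = vector [- v$2, v$1, 0]"
  by (simp add: vec_eq_iff forall_3 frame_coeffs_def J_def E1_def E2_def contact_form_def)

lemma contact_form_linear:
  "contact_form p (r *\<^sub>R v) = r * contact_form p v"
  "contact_form p (v + w) = contact_form p v + contact_form p w"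
  by (simp_all add: contact_form_def algebra_simps)

text \<open>The contact form is affine in its base point, so a vector varying affinely along a line
  gives a quadratic. The intended data are the values of \<open>F\<close>, \<open>F\<^sub>x\<close>,
  \<open>F\<^sub>y\<close>, \<open>F\<^sub>x\<^sub>y\<close> for \<open>p\<close>, \<open>v\<close>,
  \<open>w\<close>, \<open>z\<close>.\<close>

lemma contact_form_along_lines:
  "contact_form (p + t *\<^sub>R v) (w + t *\<^sub>R z) = contact_form p w
    + t * (contact_form p z + (v $ 1 * w $ 2 - v $ 2 * w $ 1)) + t\<^sup>2 * (v $ 1 * z $ 2 - v $ 2 * z $ 1)"
  by (simp add: contact_form_def power2_eq_square algebra_simps)

section \<open>Geometry of a p-minimal surface along the x-slices\<close>

locale p_minimal_coordinates =
  fixes S :: "(real^3) set" and e1 :: "real^3 \<Rightarrow> real^3"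
    and U :: "(real \<times> real) set" and F :: "real \<times> real \<Rightarrow> real^3"
  assumes characteristic: "characteristic_field S e1"
    and minimal: "p_minimal S e1"
    and coordinates: "compatible_coordinates S e1 U F"
begin

definition F\<^sub>x :: "real \<times> real \<Rightarrow> real^3" where
  "F\<^sub>x u = frechet_derivative F (at u) (1, 0)"

definition F\<^sub>y :: "real \<times> real \<Rightarrow> real^3" where
  "F\<^sub>y u = frechet_derivative F (at u) (0, 1)"

lemma parametrization: "local_parametrization S U F"
  using coordinates by (simp add: compatible_coordinates_def)

lemma open_U: "open U"
  using parametrization by (simp add: local_parametrization_def)

lemma F_in_S: "u \<in> U \<Longrightarrow> F u \<in> S"
  using parametrization openin_imp_subset by (fastforce simp: local_parametrization_def)

lemma e1_F: "u \<in> U \<Longrightarrow> e1 (F u) = F\<^sub>x u"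
  using coordinates by (simp add: compatible_coordinates_def F\<^sub>x_def)

lemma connected_slice: "connected {x. (x, y) \<in> U}"
  using coordinates by (simp add: compatible_coordinates_def)

lemma Ck_F: "Ck_on k F U"
  using parametrization by (simp add: local_parametrization_def smooth_on_def)

lemma F_has_derivative:
  assumes "(x, y) \<in> U"
  shows "((\<lambda>s. F (s, y)) has_derivative (\<lambda>h. h *\<^sub>R F\<^sub>x (x, y))) (at x)"
    and "((\<lambda>t. F (x, t)) has_derivative (\<lambda>h. h *\<^sub>R F\<^sub>y (x, y))) (at y)"
proof -
  let ?D = "frechet_derivative F (at (x, y))"
  have D: "(F has_derivative ?D) (at (x, y))"
    using Ck_on_has_derivative[OF Ck_F assms] .
  then have "?D (h, 0) = h *\<^sub>R F\<^sub>x (x, y)" "?D (0, h) = h *\<^sub>R F\<^sub>y (x, y)" for h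
    using linear_scale[OF has_derivative_linear[OF D], of h "(1, 0)"]
      linear_scale[OF has_derivative_linear[OF D], of h "(0, 1)"]
    by (simp_all add: F\<^sub>x_def F\<^sub>y_def)
  then show "((\<lambda>s. F (s, y)) has_derivative (\<lambda>h. h *\<^sub>R F\<^sub>x (x, y))) (at x)"
    "((\<lambda>t. F (x, t)) has_derivative (\<lambda>h. h *\<^sub>R F\<^sub>y (x, y))) (at y)"
    using has_derivative_Pair_slices[OF D] by simp_all
qed

definition F\<^sub>x\<^sub>y :: "real \<times> real \<Rightarrow> real^3" where
  "F\<^sub>x\<^sub>y u = frechet_derivative F\<^sub>x (at u) (0, 1)"

lemma F\<^sub>x_has_derivative:
  assumes "(x, y) \<in> U"
  shows "((\<lambda>t. F\<^sub>x (x, t)) has_derivative (\<lambda>h. h *\<^sub>R F\<^sub>x\<^sub>y (x, y))) (at y)"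
proof -
  have "Ck_on (Suc 0) F\<^sub>x U"
    using Ck_F[of "Suc (Suc 0)"] unfolding F\<^sub>x_def[abs_def] by simp
  then have D: "(F\<^sub>x has_derivative frechet_derivative F\<^sub>x (at (x, y))) (at (x, y))"
    using assms by (rule Ck_on_has_derivative)
  have "frechet_derivative F\<^sub>x (at (x, y)) (0, h) = h *\<^sub>R F\<^sub>x\<^sub>y (x, y)" for h
    using linear_scale[OF has_derivative_linear[OF D], of h "(0, 1)"]
    by (simp add: F\<^sub>x\<^sub>y_def)
  then show ?thesis
    using has_derivative_Pair_slices(2)[OF D] by simp
qed

text \<open>The third frame coefficient of \<open>e1\<close> is its contact form, which vanishes;
  unit length thus involves the first two components only.\<close>

lemma F\<^sub>x_unit: "u \<in> U \<Longrightarrow> (F\<^sub>x u $ 1)\<^sup>2 + (F\<^sub>x u $ 2)\<^sup>2 = 1"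
  and F\<^sub>x_contact: "u \<in> U \<Longrightarrow> contact_form (F u) (F\<^sub>x u) = 0"
  using characteristic F_in_S[of u] e1_F[of u]
  by (auto simp: characteristic_field_def contact_plane_def adapted_metric_def frame_coeffs_def
      inner_vec_def sum_3 power2_eq_square)

text \<open>Connectedness of the x-slices enters here.\<close>

lemma slice_constant:
  fixes f :: "real \<Rightarrow> 'b::real_normed_vector"
  assumes "\<And>s. (s, y) \<in> U \<Longrightarrow> (f has_derivative (\<lambda>h. 0)) (at s)"
    and "(x, y) \<in> U" "(x', y) \<in> U"
  shows "f x = f x'"
  using has_derivative_zero_unique_connected[OF open_Pair_slices(2)[OF open_U] connected_slice,
      of y f x x'] assms by simp

lemma F\<^sub>x_slice:
  assumes "(x, y) \<in> U" "(x', y) \<in> U"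
  shows "F\<^sub>x (x, y) = F\<^sub>x (x', y)"
proof -
  let ?I = "{s. (s, y) \<in> U}"
  have frame_derivative: "((\<lambda>s. vector [- F\<^sub>x (s, y) $ 2, F\<^sub>x (s, y) $ 1, 0] :: real^3) has_derivative (\<lambda>h. 0)) (at s)"
    if s: "(s, y) \<in> U" for s
  proof -
    \<comment> \<open>Zero p-mean curvature: differentiating the frame coefficients of
      \<open>J q (e1 q)\<close> along \<open>e1\<close> gives the coefficients of the zero
      vector.\<close>
    obtain D where D: "((\<lambda>q. frame_coeffs q (J q (e1 q))) has_derivative D) (at (F (s, y)) within S)"
      and D0: "D (e1 (F (s, y))) = frame_coeffs (F (s, y)) 0"
      using minimal F_in_S[OF s]
      unfolding p_minimal_def has_p_mean_curvature_def has_covariant_derivative_def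
      by (metis minus_zero scaleR_zero_left)
    \<comment> \<open>The curve stays in \<open>S\<close>, so the chain rule accepts a derivative
      within \<open>S\<close>; openness of the slice later removes the restriction on
      \<open>s\<close>.\<close>
    have "((\<lambda>s. F (s, y)) has_derivative (\<lambda>h. h *\<^sub>R F\<^sub>x (s, y))) (at s within ?I)"
      using F_has_derivative(1)[OF s] has_derivative_at_withinI by blast
    moreover have "((\<lambda>q. frame_coeffs q (J q (e1 q))) has_derivative D)
        (at (F (s, y)) within (\<lambda>s. F (s, y)) ` ?I)"
      using D by (rule has_derivative_subset) (auto intro: F_in_S)
    ultimately have "((\<lambda>s. frame_coeffs (F (s, y)) (J (F (s, y)) (e1 (F (s, y))))) has_derivative
        (\<lambda>h. D (h *\<^sub>R F\<^sub>x (s, y)))) (at s within ?I)"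
      by (rule has_derivative_in_compose)
    moreover have "D (h *\<^sub>R F\<^sub>x (s, y)) = 0" for h
      using D0 linear_scale[OF has_derivative_linear[OF D], of h "e1 (F (s, y))"] e1_F[OF s]
      by (simp add: frame_coeffs_def contact_form_def vec_eq_iff forall_3)
    ultimately have "((\<lambda>s. frame_coeffs (F (s, y)) (J (F (s, y)) (e1 (F (s, y))))) has_derivative
        (\<lambda>h. 0)) (at s within ?I)"
      by simp
    then have "((\<lambda>s. frame_coeffs (F (s, y)) (J (F (s, y)) (e1 (F (s, y))))) has_derivative
        (\<lambda>h. 0)) (at s)"
      using s open_Pair_slices(2)[OF open_U] by (simp add: at_within_open[of s ?I])
    then show ?thesis
      by (rule has_derivative_transform_within_open[OF _ open_Pair_slices(2)[OF open_U, of y]])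
        (use s in \<open>simp_all add: frame_coeffs_J e1_F\<close>)
  qed
  have horizontal: "F\<^sub>x (s, y) $ 1 = F\<^sub>x (x, y) $ 1" "F\<^sub>x (s, y) $ 2 = F\<^sub>x (x, y) $ 2"
    if "(s, y) \<in> U" for s
    using slice_constant[OF frame_derivative, OF _ that assms(1)] by (auto simp: vec_eq_iff forall_3)
  define p q where "p = F\<^sub>x (x, y) $ 1" and "q = F\<^sub>x (x, y) $ 2"
  \<comment> \<open>By \<open>F\<^sub>x_contact\<close> this function is the third component of
    \<open>F\<^sub>x\<close>; its derivative is qp - pq = 0.\<close>
  have "((\<lambda>s. F (s, y) $ 2 * p - F (s, y) $ 1 * q) has_derivative (\<lambda>h. 0)) (at s)"
    if s: "(s, y) \<in> U" for s
  proof -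
    have "((\<lambda>s. F (s, y) $ 2 * p - F (s, y) $ 1 * q) has_derivative
        (\<lambda>h. (h *\<^sub>R F\<^sub>x (s, y)) $ 2 * p - (h *\<^sub>R F\<^sub>x (s, y)) $ 1 * q)) (at s)"
      by (intro has_derivative_diff has_derivative_mult_left
          bounded_linear.has_derivative[OF bounded_linear_vec_nth F_has_derivative(1)[OF s]])
    then show ?thesis by (simp add: horizontal[OF s] p_def q_def)
  qed
  from slice_constant[OF this, OF _ assms]
  have "F (x, y) $ 2 * p - F (x, y) $ 1 * q = F (x', y) $ 2 * p - F (x', y) $ 1 * q"
    by simp
  then have "F\<^sub>x (x, y) $ 3 = F\<^sub>x (x', y) $ 3"
    using F\<^sub>x_contact[OF assms(1)] F\<^sub>x_contact[OF assms(2)] horizontal[OF assms(2)]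
    by (simp add: contact_form_def p_def q_def algebra_simps)
  then show ?thesis using horizontal[OF assms(2)] by (simp add: vec_eq_iff forall_3)
qed

lemma F_slice:
  assumes "(x, y) \<in> U" "(x', y) \<in> U"
  shows "F (x', y) = F (x, y) + (x' - x) *\<^sub>R F\<^sub>x (x, y)"
proof -
  have "((\<lambda>s. F (s, y) - (s - x) *\<^sub>R F\<^sub>x (x, y)) has_derivative (\<lambda>h. 0)) (at s)"
    if s: "(s, y) \<in> U" for s
    by (rule derivative_eq_intros F_has_derivative(1)[OF s] refl)+
      (simp add: F\<^sub>x_slice[OF s assms(1)])
  from slice_constant[OF this, OF _ assms] show ?thesis by (simp add: algebra_simps)
qed

text \<open>Differentiating the line in the parameter \<open>y\<close> makes the symmetry of the second derivatives
  of \<open>F\<close> unnecessary.\<close>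

lemma F\<^sub>y_slice:
  assumes "(x, y) \<in> U" "(x', y) \<in> U"
  shows "F\<^sub>y (x', y) = F\<^sub>y (x, y) + (x' - x) *\<^sub>R F\<^sub>x\<^sub>y (x, y)"
proof -
  \<comment> \<open>For \<open>t\<close> in this neighbourhood of \<open>y\<close> both points lie
    in \<open>U\<close>, so the line formula of \<open>F_slice\<close> can be differentiated in
    \<open>t\<close>.\<close>
  let ?T = "{t. (x, t) \<in> U} \<inter> {t. (x', t) \<in> U}"
  have "((\<lambda>t. F (x, t) + (x' - x) *\<^sub>R F\<^sub>x (x, t)) has_derivative
      (\<lambda>h. h *\<^sub>R (F\<^sub>y (x, y) + (x' - x) *\<^sub>R F\<^sub>x\<^sub>y (x, y)))) (at y)"
    by (rule derivative_eq_intros F_has_derivative(2)[OF assms(1)] F\<^sub>x_has_derivative[OF assms(1)] refl)+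
      (simp add: algebra_simps)
  then have "((\<lambda>t. F (x', t)) has_derivative
      (\<lambda>h. h *\<^sub>R (F\<^sub>y (x, y) + (x' - x) *\<^sub>R F\<^sub>x\<^sub>y (x, y)))) (at y)"
    by (rule has_derivative_transform_within_open[where s = ?T])
      (use assms in \<open>auto intro!: open_Int open_Pair_slices(1)[OF open_U] simp: F_slice[of x _ x']\<close>)
  from fun_cong[OF has_derivative_unique[OF this F_has_derivative(2)[OF assms(2)]], of 1]
  show ?thesis by simp
qed

text \<open>Both are y-derivatives of identities on \<open>U\<close>, namely
  \<open>F\<^sub>x_unit\<close> and \<open>F\<^sub>x_contact\<close>. The motion of the base point
  contributes the terms in \<open>F\<^sub>y\<close>.\<close>

lemma
  assumes "(x, y) \<in> U"
  shows F\<^sub>x_orthogonal_F\<^sub>x\<^sub>y: "F\<^sub>x (x, y) $ 1 * F\<^sub>x\<^sub>y (x, y) $ 1 + F\<^sub>x (x, y) $ 2 * F\<^sub>x\<^sub>y (x, y) $ 2 = 0"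
    and contact_form_F\<^sub>x\<^sub>y: "contact_form (F (x, y)) (F\<^sub>x\<^sub>y (x, y)) =
      F\<^sub>x (x, y) $ 1 * F\<^sub>y (x, y) $ 2 - F\<^sub>x (x, y) $ 2 * F\<^sub>y (x, y) $ 1"
proof -
  let ?T = "{t. (x, t) \<in> U}"
  have T: "open ?T" "y \<in> ?T" using assms open_Pair_slices(1)[OF open_U] by auto
  note der = bounded_linear.has_derivative[OF bounded_linear_vec_nth F_has_derivative(2)[OF assms]]
    bounded_linear.has_derivative[OF bounded_linear_vec_nth F\<^sub>x_has_derivative[OF assms]]
  \<comment> \<open>The constant 1 inherits the derivative of the squared length, which uniqueness
    then makes zero. The contact identity is treated alike with the constant 0.\<close>
  have "((\<lambda>t. 1) has_derivative (\<lambda>h. 2 * h * (F\<^sub>x (x, y) $ 1 * F\<^sub>x\<^sub>y (x, y) $ 1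
      + F\<^sub>x (x, y) $ 2 * F\<^sub>x\<^sub>y (x, y) $ 2))) (at y)"
  proof (rule has_derivative_transform_within_open[OF _ T])
    show "((\<lambda>t. (F\<^sub>x (x, t) $ 1)\<^sup>2 + (F\<^sub>x (x, t) $ 2)\<^sup>2) has_derivative
      (\<lambda>h. 2 * h * (F\<^sub>x (x, y) $ 1 * F\<^sub>x\<^sub>y (x, y) $ 1
      + F\<^sub>x (x, y) $ 2 * F\<^sub>x\<^sub>y (x, y) $ 2))) (at y)"
      by (rule derivative_eq_intros der refl)+ (simp add: algebra_simps)
  qed (simp add: F\<^sub>x_unit)
  from fun_cong[OF has_derivative_unique[OF this has_derivative_const], of 1]
  show "F\<^sub>x (x, y) $ 1 * F\<^sub>x\<^sub>y (x, y) $ 1 + F\<^sub>x (x, y) $ 2 * F\<^sub>x\<^sub>y (x, y) $ 2 = 0" by simp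
  let ?d = "contact_form (F (x, y)) (F\<^sub>x\<^sub>y (x, y)) + F\<^sub>y (x, y) $ 1 * F\<^sub>x (x, y) $ 2
    - F\<^sub>y (x, y) $ 2 * F\<^sub>x (x, y) $ 1"
  have "((\<lambda>t. 0) has_derivative (\<lambda>h. h * ?d)) (at y)"
  proof (rule has_derivative_transform_within_open[OF _ T])
    show "((\<lambda>t. contact_form (F (x, t)) (F\<^sub>x (x, t))) has_derivative (\<lambda>h. h * ?d)) (at y)"
      unfolding contact_form_def
      by (rule derivative_eq_intros der refl)+ (simp add: algebra_simps)
  qed (simp add: F\<^sub>x_contact)
  from fun_cong[OF has_derivative_unique[OF this has_derivative_const], of 1]
  show "contact_form (F (x, y)) (F\<^sub>x\<^sub>y (x, y)) =
      F\<^sub>x (x, y) $ 1 * F\<^sub>y (x, y) $ 2 - F\<^sub>x (x, y) $ 2 * F\<^sub>y (x, y) $ 1"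
    by (simp add: algebra_simps)
qed

text \<open>The factor 2 arises because the linear term occurs twice: once from the moving base
  point, once from \<open>F\<^sub>x\<^sub>y\<close> through
  \<open>contact_form_F\<^sub>x\<^sub>y\<close>.\<close>

lemma contact_form_F\<^sub>y_slice:
  assumes "(x, y) \<in> U" "(x', y) \<in> U"
  shows "contact_form (F (x', y)) (F\<^sub>y (x', y)) = contact_form (F (x, y)) (F\<^sub>y (x, y))
      + 2 * (x' - x) * (F\<^sub>x (x, y) $ 1 * F\<^sub>y (x, y) $ 2 - F\<^sub>x (x, y) $ 2 * F\<^sub>y (x, y) $ 1)
      + (x' - x)\<^sup>2 * (F\<^sub>x (x, y) $ 1 * F\<^sub>x\<^sub>y (x, y) $ 2 - F\<^sub>x (x, y) $ 2 * F\<^sub>x\<^sub>y (x, y) $ 1)"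
  unfolding F_slice[OF assms] F\<^sub>y_slice[OF assms] contact_form_along_lines
    contact_form_F\<^sub>x\<^sub>y[OF assms(1)]
  by (simp add: algebra_simps)

end

section \<open>The coefficients \<open>a\<close> and \<open>b\<close> read off from the frame
  expansion\<close>

lemma induced_metric_coefficients:
  assumes "induced_metric_represented_by e1 \<alpha> U F a b" "u \<in> U"
    and "p_minimal_coordinates S e1 U F"
  defines "s \<equiv> sqrt (1 + (\<alpha> (F u))\<^sup>2)"
    and "P \<equiv> frechet_derivative F (at u) (1, 0)" and "Q \<equiv> frechet_derivative F (at u) (0, 1)"
  shows "b u * s * contact_form (F u) Q = 1"
    and "P $ 1 * Q $ 2 - P $ 2 * Q $ 1 = \<alpha> (F u) * contact_form (F u) Q"
    and "a u / b u = - (P $ 1 * Q $ 1 + P $ 2 * Q $ 2)"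
proof -
  interpret p_minimal_coordinates S e1 U F by fact
  have P: "e1 (F u) = P" "(P $ 1)\<^sup>2 + (P $ 2)\<^sup>2 = 1" "contact_form (F u) P = 0"
    using e1_F[OF assms(2)] F\<^sub>x_unit[OF assms(2)] F\<^sub>x_contact[OF assms(2)]
    by (simp_all only: F\<^sub>x_def P_def)
  have s: "s > 0" by (simp add: s_def add_pos_nonneg)
  have b: "b u > 0" and "e2_hat e1 \<alpha> (F u) = a u *\<^sub>R P + b u *\<^sub>R Q"
    using assms(1,2) unfolding induced_metric_represented_by_def P_def Q_def by blast+
  then have e: "(1 / s) *\<^sub>R (\<alpha> (F u) *\<^sub>R J (F u) P + Reeb (F u)) = a u *\<^sub>R P + b u *\<^sub>R Q"
    by (simp only: e2_hat_def P(1) s_def)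
  \<comment> \<open>The contact form kills \<open>P\<close> and \<open>J (F u) P\<close>, so it
    isolates the coefficient of \<open>Q\<close>.\<close>
  have "contact_form (F u) (J (F u) P) = 0" "contact_form (F u) (Reeb (F u)) = 1"
    by (simp_all add: contact_form_def J_def frame_coeffs_def E1_def E2_def Reeb_def)
  then have V: "1 / s = b u * contact_form (F u) Q"
    using arg_cong[OF e, of "contact_form (F u)"] P(3) by (simp add: contact_form_linear)
  then show "b u * s * contact_form (F u) Q = 1"
    using s nonzero_divide_eq_eq[of s 1] by (simp add: mult_ac)
  \<comment> \<open>The component of \<open>e2_hat\<close> along \<open>J (F u) P\<close>; the next
    two facts are the first two coordinates of the expansion.\<close>
  define m where "m = \<alpha> (F u) / s"
  have 1: "- m * P $ 2 = a u * P $ 1 + b u * Q $ 1"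
    using arg_cong[OF e, of "\<lambda>v. v $ 1"]
    by (simp add: J_def frame_coeffs_def E1_def E2_def Reeb_def m_def)
  have 2: "m * P $ 1 = a u * P $ 2 + b u * Q $ 2"
    using arg_cong[OF e, of "\<lambda>v. v $ 2"]
    by (simp add: J_def frame_coeffs_def E1_def E2_def Reeb_def m_def)
  \<comment> \<open>Pairing the horizontal components with those of \<open>J (F u) P\<close>
    eliminates \<open>a\<close>.\<close>
  have "m * ((P $ 1)\<^sup>2 + (P $ 2)\<^sup>2) = P $ 1 * (m * P $ 1) - P $ 2 * (- m * P $ 2)"
    by (simp add: power2_eq_square algebra_simps)
  also have "\<dots> = b u * (P $ 1 * Q $ 2 - P $ 2 * Q $ 1)"
    unfolding 1 2 by (simp add: algebra_simps)
  finally have "b u * (P $ 1 * Q $ 2 - P $ 2 * Q $ 1) = m" using P(2) by simp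
  also have "m = b u * (\<alpha> (F u) * contact_form (F u) Q)"
    using arg_cong[OF V, of "\<lambda>r. \<alpha> (F u) * r"] by (simp add: m_def mult.left_commute)
  finally show "P $ 1 * Q $ 2 - P $ 2 * Q $ 1 = \<alpha> (F u) * contact_form (F u) Q"
    using b by simp
  \<comment> \<open>Pairing with those of \<open>P\<close> instead eliminates
    \<open>m\<close>.\<close>
  have "a u * ((P $ 1)\<^sup>2 + (P $ 2)\<^sup>2) + b u * (P $ 1 * Q $ 1 + P $ 2 * Q $ 2)
      = P $ 1 * (a u * P $ 1 + b u * Q $ 1) + P $ 2 * (a u * P $ 2 + b u * Q $ 2)"
    by (simp add: power2_eq_square algebra_simps)
  also have "\<dots> = 0" unfolding 1[symmetric] 2[symmetric] by simp
  finally have "a u = - (P $ 1 * Q $ 1 + P $ 2 * Q $ 2) * b u"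
    using P(2) by (simp add: algebra_simps)
  then show "a u / b u = - (P $ 1 * Q $ 1 + P $ 2 * Q $ 2)"
    using b by (simp add: field_simps)
qed

text \<open>Algebraic substitute for solving V' = 2V/(x + c_1) among quadratics. Here
  \<open>d\<close> is x + c_1 at the first point, \<open>t\<close> the step and \<open>V'\<close>
  the value at the second point, not a derivative; the second hypothesis equates two expressions for
  half the slope there.\<close>

lemma quadratic_with_double_root:
  fixes V V' d w t :: real
  assumes "V' = V + 2 * t * (V / d) + t\<^sup>2 * w" "V / d + t * w = V' / (d + t)" "d \<noteq> 0" "d + t \<noteq> 0"
  shows "V' / (d + t)\<^sup>2 = V / d\<^sup>2"
proof -
  have "(d + t) * (V / d + t * w) = V + 2 * t * (V / d) + t\<^sup>2 * w"
    using assms by simp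
  \<comment> \<open>Keeping the factor \<open>t\<close> covers coinciding points as well.\<close>
  then have "t * (d * w - V / d) = 0"
    using assms(3) by (simp add: field_simps power2_eq_square)
  then have "t * w = t * (V / d\<^sup>2)"
    using assms(3) by (auto simp: field_simps power2_eq_square)
  then have "V' = V + 2 * t * (V / d) + t * (t * (V / d\<^sup>2))"
    by (simp only: assms(1) power2_eq_square mult.assoc \<open>t * w = t * (V / d\<^sup>2)\<close>)
  also have "\<dots> = V / d\<^sup>2 * (d + t)\<^sup>2"
    using assms(3) by (simp add: field_simps power2_eq_square)
  finally show ?thesis using assms(4) by simp
qed

section \<open>The functions \<open>h\<close> and \<open>k\<close>\<close>

theorem proposition5p4:
  fixes S :: "(real^3) set"
    and e1 :: "real^3 \<Rightarrow> real^3"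
    and \<alpha> :: "real^3 \<Rightarrow> real"
    and U :: "(real \<times> real) set"
    and F :: "real \<times> real \<Rightarrow> real^3"
    and a b :: "real \<times> real \<Rightarrow> real"
    and c1 :: "real \<Rightarrow> real"
  assumes "nonsingular_surface S"
    and "characteristic_field S e1"
    and "p_minimal S e1"
    and "alpha_function S e1 \<alpha>"
    and "compatible_coordinates S e1 U F"
    and "induced_metric_represented_by e1 \<alpha> U F a b"
    and "\<And>x y. (x, y) \<in> U \<Longrightarrow> x + c1 y \<noteq> 0 \<and> \<alpha> (F (x, y)) = 1 / (x + c1 y)"
  shows "\<exists>h k :: real \<Rightarrow> real.
           smooth_on (snd ` U) h \<and> smooth_on (snd ` U) k \<and>
           (\<forall>x y. (x, y) \<in> U \<longrightarrow>
              a (x, y) = (\<alpha> (F (x, y)))\<^sup>2 * h y / sqrt (1 + (\<alpha> (F (x, y)))\<^sup>2) \<and>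
              b (x, y) = (\<alpha> (F (x, y)))\<^sup>2 * exp (k y) / sqrt (1 + (\<alpha> (F (x, y)))\<^sup>2))"
proof -
  interpret p_minimal_coordinates S e1 U F
    using assms(2,3,5) by unfold_locales
  let ?\<alpha> = "\<lambda>u. \<alpha> (F u)"
  let ?V = "\<lambda>u. contact_form (F u) (F\<^sub>y u)"
  define s where "s u = sqrt (1 + (?\<alpha> u)\<^sup>2)" for u
  note met = induced_metric_coefficients[OF assms(6) _ p_minimal_coordinates_axioms,
      folded F\<^sub>x_def F\<^sub>y_def s_def]
  have s: "s u > 0" "(s u)\<^sup>2 = 1 + (?\<alpha> u)\<^sup>2" for u
    by (simp_all add: s_def add_pos_nonneg)
  have b: "b u > 0" if "u \<in> U" for u
    using assms(6) that by (simp add: induced_metric_represented_by_def)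
  have \<alpha>: "?\<alpha> u \<noteq> 0" if "u \<in> U" for u
    using assms(7)[of "fst u" "snd u"] that by simp
  have \<alpha>_sq: "?\<alpha> u * ?\<alpha> u > 0" if "u \<in> U" for u
    using \<alpha>[OF that] not_real_square_gt_zero by blast
  have smooth: "Ck_on k a U" "Ck_on k b U" "Ck_on k ?\<alpha> U" for k
    using assms(4,6) parametrization
    by (auto simp: induced_metric_represented_by_def smooth_on_def alpha_function_def
        smooth_on_surface_def)
  \<comment> \<open>The desired formula for \<open>b\<close> amounts to w = e^k, so \<open>k\<close>
    must be \<open>ln w\<close>; hence \<open>w\<close> has to be positive and constant on
    slices.\<close>
  define w where "w u = b u * s u / (?\<alpha> u)\<^sup>2" for u
  have w_pos: "w u > 0" if "u \<in> U" for u
    using b[OF that] s(1)[of u] \<alpha>[OF that] by (simp add: w_def)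
  have w_slice: "w (x, y) = w (x', y)" if u: "(x, y) \<in> U" and u': "(x', y) \<in> U" for x x' y
  proof -
    \<comment> \<open>Since b s V = 1 and 1/\<alpha> = r + c_1, constancy of \<open>w\<close>
      becomes constancy of V/(r + c_1)^2.\<close>
    have w: "w (r, y) = 1 / (?V (r, y) / (r + c1 y)\<^sup>2)" if r: "(r, y) \<in> U" for r
    proof -
      have "b (r, y) * s (r, y) = 1 / ?V (r, y)"
        using met(1)[OF r] by (cases "?V (r, y) = 0") (simp_all add: field_simps)
      then show ?thesis
        using assms(7)[OF r] by (simp add: w_def power_divide)
    qed
    have "?V (x', y) / (x + c1 y + (x' - x))\<^sup>2 = ?V (x, y) / (x + c1 y)\<^sup>2"
    proof (rule quadratic_with_double_root)
      let ?w = "F\<^sub>x (x, y) $ 1 * F\<^sub>x\<^sub>y (x, y) $ 2 - F\<^sub>x (x, y) $ 2 * F\<^sub>x\<^sub>y (x, y) $ 1"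
      show "?V (x', y) = ?V (x, y) + 2 * (x' - x) * (?V (x, y) / (x + c1 y)) + (x' - x)\<^sup>2 * ?w"
        using contact_form_F\<^sub>y_slice[OF u u'] met(2)[OF u] assms(7)[OF u] by simp
      \<comment> \<open>Half the slope of V at \<open>x'\<close> is computed twice: as \<alpha>V
        there, and from the affine dependence of \<open>F\<^sub>y\<close> on x.\<close>
      have "?V (x', y) / (x' + c1 y) =
          F\<^sub>x (x', y) $ 1 * F\<^sub>y (x', y) $ 2 - F\<^sub>x (x', y) $ 2 * F\<^sub>y (x', y) $ 1"
        using met(2)[OF u'] assms(7)[OF u'] by simp
      also have "\<dots> = (F\<^sub>x (x, y) $ 1 * F\<^sub>y (x, y) $ 2 - F\<^sub>x (x, y) $ 2 * F\<^sub>y (x, y) $ 1)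
          + (x' - x) * ?w"
        by (simp add: F\<^sub>x_slice[OF u' u] F\<^sub>y_slice[OF u u'] algebra_simps)
      also have "\<dots> = ?V (x, y) / (x + c1 y) + (x' - x) * ?w"
        using met(2)[OF u] assms(7)[OF u] by simp
      finally show "?V (x, y) / (x + c1 y) + (x' - x) * ?w = ?V (x', y) / (x + c1 y + (x' - x))"
        by (simp add: algebra_simps)
    qed (use assms(7)[OF u] assms(7)[OF u'] in \<open>simp_all add: algebra_simps\<close>)
    then show ?thesis
      unfolding w[OF u] w[OF u'] by (simp add: algebra_simps)
  qed
  have ratio_slice: "a (x, y) * inverse (b (x, y)) = a (x', y) * inverse (b (x', y))"
    if u: "(x, y) \<in> U" and u': "(x', y) \<in> U" for x x' y
  proof -
    \<comment> \<open>The x-slope of this inner product vanishes by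
      \<open>F\<^sub>x_orthogonal_F\<^sub>x\<^sub>y\<close>.\<close>
    have "F\<^sub>x (x', y) $ 1 * F\<^sub>y (x', y) $ 1 + F\<^sub>x (x', y) $ 2 * F\<^sub>y (x', y) $ 2 =
        F\<^sub>x (x, y) $ 1 * F\<^sub>y (x, y) $ 1 + F\<^sub>x (x, y) $ 2 * F\<^sub>y (x, y) $ 2
        + (x' - x) * (F\<^sub>x (x, y) $ 1 * F\<^sub>x\<^sub>y (x, y) $ 1 + F\<^sub>x (x, y) $ 2 * F\<^sub>x\<^sub>y (x, y) $ 2)"
      by (simp add: F\<^sub>x_slice[OF u' u] F\<^sub>y_slice[OF u u'] algebra_simps)
    then show ?thesis
      using met(3)[OF u] met(3)[OF u'] F\<^sub>x_orthogonal_F\<^sub>x\<^sub>y[OF u] by (simp add: divide_inverse)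
  qed
  \<comment> \<open>Written with products, inverses and logarithms only, so that no smoothness of the square root
    is needed.\<close>
  have log_w: "1/2 * ln (b u * b u * (1 + ?\<alpha> u * ?\<alpha> u) * inverse (?\<alpha> u * ?\<alpha> u * (?\<alpha> u * ?\<alpha> u)))
      = ln (w u)" if "u \<in> U" for u
  proof -
    have "b u * b u * (1 + ?\<alpha> u * ?\<alpha> u) * inverse (?\<alpha> u * ?\<alpha> u * (?\<alpha> u * ?\<alpha> u)) = (w u)\<^sup>2"
      using s(2)[of u] \<alpha>[OF that] by (simp add: w_def field_simps power2_eq_square)
    then show ?thesis using w_pos[OF that] by (simp add: ln_realpow)
  qed
  have Ck_log_w: "Ck_on k (\<lambda>u. ln (w u)) U" for k
  proof (rule Ck_on_cong[OF open_U log_w])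
    show "Ck_on k (\<lambda>u. 1/2 * ln (b u * b u * (1 + ?\<alpha> u * ?\<alpha> u)
        * inverse (?\<alpha> u * ?\<alpha> u * (?\<alpha> u * ?\<alpha> u)))) U"
      by (intro Ck_on_mult Ck_on_ln Ck_on_add Ck_on_inverse Ck_on_const smooth open_U)
        (auto simp: \<alpha> simp del: inverse_mult_distrib
          intro!: mult_pos_pos add_pos_pos positive_imp_inverse_positive b \<alpha>_sq)
  qed
  obtain k where k: "smooth_on (snd ` U) k" "\<And>x y. (x, y) \<in> U \<Longrightarrow> ln (w (x, y)) = k y"
  proof (rule smooth_on_descends[OF open_U])
    show "smooth_on U (\<lambda>u. ln (w u))" unfolding smooth_on_def using Ck_log_w by blast
    show "ln (w (x, y)) = ln (w (x', y))" if "(x, y) \<in> U" "(x', y) \<in> U" for x x' y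
      using w_slice[OF that] by simp
  qed blast
  \<comment> \<open>The formula for \<open>a\<close> demands h = a s/\<alpha>^2 = (a/b) w; writing
    \<open>w\<close> as \<open>exp (ln w)\<close> draws its smoothness from
    \<open>Ck_log_w\<close>.\<close>
  obtain h where h: "smooth_on (snd ` U) h"
    "\<And>x y. (x, y) \<in> U \<Longrightarrow> a (x, y) * inverse (b (x, y)) * exp (ln (w (x, y))) = h y"
  proof (rule smooth_on_descends[OF open_U])
    have "b u \<noteq> 0" if "u \<in> U" for u using b[OF that] by simp
    then show "smooth_on U (\<lambda>u. a u * inverse (b u) * exp (ln (w u)))"
      unfolding smooth_on_def by (intro allI Ck_on_mult Ck_on_inverse Ck_on_exp Ck_log_w smooth open_U)
    show "a (x, y) * inverse (b (x, y)) * exp (ln (w (x, y)))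
        = a (x', y) * inverse (b (x', y)) * exp (ln (w (x', y)))"
      if "(x, y) \<in> U" "(x', y) \<in> U" for x x' y
      using w_slice[OF that] ratio_slice[OF that] by simp
  qed blast
  have "a (x, y) = (?\<alpha> (x, y))\<^sup>2 * h y / s (x, y) \<and> b (x, y) = (?\<alpha> (x, y))\<^sup>2 * exp (k y) / s (x, y)"
    if u: "(x, y) \<in> U" for x y
  proof -
    have ek: "exp (k y) = w (x, y)" and hy: "h y = a (x, y) / b (x, y) * w (x, y)"
      using k(2)[OF u] h(2)[OF u] w_pos[OF u] by (auto simp: divide_inverse dest: sym)
    show ?thesis
      unfolding ek hy using b[OF u] s(1)[of "(x, y)"] \<alpha>[OF u] by (simp add: w_def)
  qed
  then show ?thesis using k(1) h(1) unfolding s_def by blast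
qed

end
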